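(* Let $U = \{1,2,3,4\}$ and $V = \{a,b\}$ (with $a \neq b$), and define $f : U \to V$ by $$f(1)=f(2)=a, \qquad f(3)=f(4)=b.$$ Let $R$ be the equivalence relation on $U$ whose equivalence classes are $\{1\}, \{2,3\}, \{4\}$, and let $X = \{1\}$. Then $\underline{\mathrm{apr}}_R X = \overline{\mathrm{apr}}_R X = X = \{1\}$, $f(X) = \{a\}$, $f(R) = \{(a,a),(b,b),(a,b),(b,a)\}$, $\underline{\mathrm{apr}}_{f(R)} f(X) = \emptyset$ and $\overline{\mathrm{apr}}_{f(R)} f(X) = V$. Therefore $$f(\underline{\mathrm{apr}}_R X) = f(X) = \{a\} \supsetneq \emptyset = \underline{\mathrm{apr}}_{f(R)} f(X),$$ $$f(\overline{\mathrm{apr}}_R X) = f(X) = \{a\} \subsetneq V = \overline{\mathrm{apr}}_{f(R)} f(X).$$ Consequently, for surjective mappings $f$ between finite sets, equivalence relations $R$ on the domain and subsets $X$ of the domain: neither the inclusion $f(\underline{\mathrm{apr}}_R X) \subseteq \underline{\mathrm{apr}}_{f(R)} f(X)$ nor the inclusion $f(\overline{\mathrm{apr}}_R X) \supseteq \overline{\mathrm{apr}}_{f(R)} f(X)$ holds in general; and, even under the assumption $\underline{\mathrm{apr}}_R X = \overline{\mathrm{apr}}_R X = X$, neither $f(\underline{\mathrm{apr}}_R X) = \underline{\mathrm{apr}}_{f(R)} f(X) = f(X)$ nor $f(\overline{\mathrm{apr}}_R X) = \overline{\mathrm{apr}}_{f(R)} f(X) = f(X)$ holds in general.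
   Context: Equivalence relations on a set $U$ are regarded as subsets of $U \times U$. For an equivalence relation $R$ on a finite nonempty set $U$ and $x \in U$, write $[x]_R = \{y \in U \mid (x,y) \in R\}$, and let $U/R$ be the set of equivalence classes of $R$. For $X \subseteq U$, the lower and upper approximations of $X$ are $$\underline{\mathrm{apr}}_R X = \bigcup \{C \in U/R \mid C \subseteq X\}, \qquad \overline{\mathrm{apr}}_R X = \bigcup \{C \in U/R \mid C \cap X \neq \emptyset\};$$ the same definitions are used for equivalence relations on $V$ and subsets of $V$. Given a surjective mapping $f : U \to V$ between finite sets, write $[x]_f = \{y \in U \mid f(y) = f(x)\}$ for $x \in U$, and $f(X)$ for the image of a subset $X \subseteq U$. The including degree of $[x]_R$ with respect to $[x]_f$ is $D([x]_R/[x]_f) = |[x]_f \cap [x]_R|/|[x]_f|$, where $|S|$ denotes the cardinality of a set $S$. For an equivalence relation $R$ on $U$, the general relation mapping induced by $f$ (denoted by the same letter $f$) sends $R$ to the relation on $V$ $$f(R) = \{(f(x), f(y)) \mid (x,y) \in R \text{ and } D([x]_R/[x]_f) = D([y]_R/[y]_f)\}.$$ *)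

theory Defs
  imports Complex_Main
begin

definition lower_apr :: "'a set \<Rightarrow> 'a rel \<Rightarrow> 'a set \<Rightarrow> 'a set" where
  "lower_apr U R X = \<Union> {C \<in> U // R. C \<subseteq> X}"

definition upper_apr :: "'a set \<Rightarrow> 'a rel \<Rightarrow> 'a set \<Rightarrow> 'a set" where
  "upper_apr U R X = \<Union> {C \<in> U // R. C \<inter> X \<noteq> {}}"

definition fibre_class :: "'a set \<Rightarrow> ('a \<Rightarrow> 'b) \<Rightarrow> 'a \<Rightarrow> 'a set" where
  "fibre_class U f x = {y \<in> U. f y = f x}"

text \<open>\<open>including_degree C E\<close> is written \<open>D(C/E)\<close> in the literature.\<close>

definition including_degree :: "'a set \<Rightarrow> 'a set \<Rightarrow> real" where
  "including_degree C E = real (card (E \<inter> C)) / real (card E)"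

text \<open>
  The relation \<open>f(R)\<close> on \<open>f ` U\<close>. The class of \<open>x\<close> is \<open>R `` {x}\<close>, which lies in \<open>U\<close>
  because \<open>equiv U R\<close> includes \<open>R \<subseteq> U \<times> U\<close>.
\<close>

definition rel_map :: "'a set \<Rightarrow> ('a \<Rightarrow> 'b) \<Rightarrow> 'a rel \<Rightarrow> 'b rel" where
  "rel_map U f R = {(f x, f y) | x y. (x, y) \<in> R \<and>
     including_degree (R `` {x}) (fibre_class U f x) =
     including_degree (R `` {y}) (fibre_class U f y)}"

text \<open>
  The data over which the general claims range. In general \<open>f(R)\<close> need not be transitive,
  whereas approximations are taken with respect to equivalence relations; hence the last
  conjunct. Since the setting only occurs as a hypothesis of universal claims that are
  refuted, this conjunct makes the refutations stronger.
\<close>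

definition rel_map_setting ::
    "'a set \<Rightarrow> 'b set \<Rightarrow> ('a \<Rightarrow> 'b) \<Rightarrow> 'a rel \<Rightarrow> 'a set \<Rightarrow> bool" where
  "rel_map_setting U V f R X \<longleftrightarrow>
     finite U \<and> U \<noteq> {} \<and> finite V \<and> f ` U = V \<and> equiv U R \<and> X \<subseteq> U \<and>
     equiv V (rel_map U f R)"

end

(*
  Each R-class meets the fibre of each of its elements in exactly one of the two points, so every
  including degree is 1/2 and f(R) is the full image of R under f. The class {2, 3} joins the two
  fibres, so f(R) has the single class {a, b}: it does not fit in f(X) = {a}, but it meets it.
*)
theory Submission
  imports Defs
begin

text \<open>Being related means lying in a common class: \<open>y\<close> lies in the class of
  \<open>x\<close>, and two members of one class are related by \<open>quotient_eq_iff\<close>.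
  Needed because the example prescribes the classes of the relation, while its image under
  \<open>f\<close> is computed from pairs.\<close>

lemma equiv_eq_Union_quotient:
  assumes "equiv A R"
  shows "R = (\<Union>C \<in> A // R. C \<times> C)"
proof (intro equalityI subrelI)
  fix x y assume "(x, y) \<in> R"
  then have "R `` {x} \<in> A // R" "x \<in> R `` {x}" "y \<in> R `` {x}"
    using assms by (auto simp: equiv_def refl_on_def intro: quotientI)
  then show "(x, y) \<in> (\<Union>C \<in> A // R. C \<times> C)"
    by blast
next
  fix x y assume "(x, y) \<in> (\<Union>C \<in> A // R. C \<times> C)"
  then show "(x, y) \<in> R"
    using assms by (auto dest: quotient_eq_iff)
qed

lemma quotient_Times_self: "A \<noteq> {} \<Longrightarrow> A // (A \<times> A) = {A}"
  by (auto simp: quotient_def)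

lemma equiv_Times_self: "equiv A (A \<times> A)"
  by (auto simp: equiv_def refl_on_def sym_def trans_def)

text \<open>The example is kept abstract in the codomain type and in the relation, since it serves
  twice: for arbitrary data in the first conjunct of the theorem, and for one concrete instance in
  the refutations.\<close>

locale merging_example =
  fixes a b :: 'b and f :: "nat \<Rightarrow> 'b" and R :: "nat rel"
  assumes ab: "a \<noteq> b"
    and f: "f 1 = a" "f 2 = a" "f 3 = b" "f 4 = b"
    and equiv: "equiv {1, 2, 3, 4} R"
    and quotient: "{1, 2, 3, 4} // R = {{1}, {2, 3}, {4}}"
begin

lemma R_eq: "R = {(1, 1), (2, 2), (2, 3), (3, 2), (3, 3), (4, 4)}"
  by (subst equiv_eq_Union_quotient[OF equiv], unfold quotient) auto

lemma image_eq: "f ` {1, 2, 3, 4} = {a, b}"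
  \<comment> \<open>With \<open>One_nat_def\<close> active, \<open>1\<close> would turn into
    \<open>Suc 0\<close> and the equation for \<open>f 1\<close> would no longer match.\<close>
  by (auto simp: f simp del: One_nat_def)

lemma lower_apr_eq: "lower_apr {1, 2, 3, 4} R {1} = {1}"
  unfolding lower_apr_def quotient by auto

lemma upper_apr_eq: "upper_apr {1, 2, 3, 4} R {1} = {1}"
  unfolding upper_apr_def quotient by auto

lemma including_degree_eq:
  \<comment> \<open>At any other point the class is empty, so the degree would be 0.\<close>
  assumes "x \<in> {1, 2, 3, 4}"
  shows "including_degree (R `` {x}) (fibre_class {1, 2, 3, 4} f x) = 1 / 2"
proof -
  have fib: "fibre_class {1, 2, 3, 4} f 1 = {1, 2}" "fibre_class {1, 2, 3, 4} f 2 = {1, 2}"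
    "fibre_class {1, 2, 3, 4} f 3 = {3, 4}" "fibre_class {1, 2, 3, 4} f 4 = {3, 4}"
    using ab by (auto simp: fibre_class_def f simp del: One_nat_def)
  have cls: "R `` {1} = {1}" "R `` {2} = {2, 3}" "R `` {3} = {2, 3}" "R `` {4} = {4}"
    by (auto simp: R_eq)
  show ?thesis
    using assms by (auto simp: fib cls including_degree_def simp del: One_nat_def)
qed

lemma rel_map_eq: "rel_map {1, 2, 3, 4} f R = {a, b} \<times> {a, b}"
proof -
  have "including_degree (R `` {x}) (fibre_class {1, 2, 3, 4} f x) =
      including_degree (R `` {y}) (fibre_class {1, 2, 3, 4} f y)" if "(x, y) \<in> R" for x y
  proof -
    have "x \<in> {1, 2, 3, 4}" "y \<in> {1, 2, 3, 4}"
      using that by (auto simp: R_eq)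
    then show ?thesis
      by (simp only: including_degree_eq)
  qed
  \<comment> \<open>The equality of degrees holds for related points only; \<open>conj_cong\<close>
    makes membership in \<open>R\<close> available while that conjunct is simplified away.\<close>
  then have "rel_map {1, 2, 3, 4} f R = {(f x, f y) | x y. (x, y) \<in> R}"
    unfolding rel_map_def by (simp cong: conj_cong)
  also have "\<dots> = (\<lambda>(x, y). (f x, f y)) ` R"
    by auto
  \<comment> \<open>The pairs (2, 3) and (3, 2) supply the mixed pairs (a, b) and (b, a); the
    diagonal of \<open>R\<close> supplies the other two.\<close>
  also have "\<dots> = {a, b} \<times> {a, b}"
    unfolding R_eq by (auto simp: f simp del: One_nat_def)
  finally show ?thesis .
qed

lemma lower_apr_rel_map: "lower_apr {a, b} (rel_map {1, 2, 3, 4} f R) {a} = {}"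
  unfolding lower_apr_def rel_map_eq quotient_Times_self[OF insert_not_empty] using ab by auto

lemma upper_apr_rel_map: "upper_apr {a, b} (rel_map {1, 2, 3, 4} f R) {a} = {a, b}"
  unfolding upper_apr_def rel_map_eq quotient_Times_self[OF insert_not_empty] by auto

text \<open>Admits the example as a counterexample to the general claims. The image relation is a
  full product, hence an equivalence.\<close>

lemma setting: "rel_map_setting {1, 2, 3, 4} {a, b} f R {1}"
  unfolding rel_map_setting_def rel_map_eq
  by (intro conjI equiv image_eq equiv_Times_self) auto

end

text \<open>The first conjunct of the theorem is vacuous when the codomain type has a single
  element, so the refutations need an actual instance. The threshold 2 separates the fibres {1, 2}
  and {3, 4}.\<close>

lemma merging_example_nat:
  "merging_example 0 1 (\<lambda>n. if n \<le> 2 then 0 else (1 :: nat))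
     {(1, 1), (2, 2), (2, 3), (3, 2), (3, 3), (4, 4)}"
proof
  let ?R = "{(1, 1), (2, 2), (2, 3), (3, 2), (3, 3), (4, 4)} :: nat rel"
  show "equiv {1, 2, 3, 4} ?R"
    by (auto simp: equiv_def refl_on_def sym_def trans_def)
  \<comment> \<open>The four points yield only three classes, because 2 and 3 produce the same
    one.\<close>
  have "?R `` {1} = {1}" "?R `` {2} = {2, 3}" "?R `` {3} = {2, 3}" "?R `` {4} = {4}"
    by auto
  then show "{1, 2, 3, 4} // ?R = {{1}, {2, 3}, {4}}"
    unfolding quotient_def by (simp add: insert_commute del: One_nat_def)
qed auto

theorem mainTheorem2:
  shows
    "(\<forall>(U :: nat set) (V :: 'b set) (a :: 'b) (b :: 'b) (f :: nat \<Rightarrow> 'b) (R :: nat rel) (X :: nat set).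
        U = {1, 2, 3, 4} \<and> a \<noteq> b \<and> V = {a, b} \<and>
        f 1 = a \<and> f 2 = a \<and> f 3 = b \<and> f 4 = b \<and>
        equiv U R \<and> U // R = {{1}, {2, 3}, {4}} \<and> X = {1} \<longrightarrow>
          f ` U = V \<and>
          lower_apr U R X = X \<and> upper_apr U R X = X \<and>
          f ` X = {a} \<and>
          rel_map U f R = {(a, a), (b, b), (a, b), (b, a)} \<and>
          equiv V (rel_map U f R) \<and>
          lower_apr V (rel_map U f R) (f ` X) = {} \<and>
          upper_apr V (rel_map U f R) (f ` X) = V \<and>
          f ` lower_apr U R X = f ` X \<and>
          f ` lower_apr U R X \<supset> lower_apr V (rel_map U f R) (f ` X) \<and>
          f ` upper_apr U R X = f ` X \<and>
          f ` upper_apr U R X \<subset> upper_apr V (rel_map U f R) (f ` X))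
     \<and>
     \<not> (\<forall>(U :: nat set) (V :: nat set) f R X. rel_map_setting U V f R X \<longrightarrow>
          f ` lower_apr U R X \<subseteq> lower_apr V (rel_map U f R) (f ` X))
     \<and>
     \<not> (\<forall>(U :: nat set) (V :: nat set) f R X. rel_map_setting U V f R X \<longrightarrow>
          f ` upper_apr U R X \<supseteq> upper_apr V (rel_map U f R) (f ` X))
     \<and>
     \<not> (\<forall>(U :: nat set) (V :: nat set) f R X. rel_map_setting U V f R X \<and>
          lower_apr U R X = upper_apr U R X \<and> upper_apr U R X = X \<longrightarrow>
          f ` lower_apr U R X = lower_apr V (rel_map U f R) (f ` X) \<and>
          lower_apr V (rel_map U f R) (f ` X) = f ` X)
     \<and>
     \<not> (\<forall>(U :: nat set) (V :: nat set) f R X. rel_map_setting U V f R X \<and>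
          lower_apr U R X = upper_apr U R X \<and> upper_apr U R X = X \<longrightarrow>
          f ` upper_apr U R X = upper_apr V (rel_map U f R) (f ` X) \<and>
          upper_apr V (rel_map U f R) (f ` X) = f ` X)"
proof (intro conjI)
  show "\<forall>(U :: nat set) (V :: 'b set) (a :: 'b) (b :: 'b) (f :: nat \<Rightarrow> 'b) (R :: nat rel) (X :: nat set).
        U = {1, 2, 3, 4} \<and> a \<noteq> b \<and> V = {a, b} \<and>
        f 1 = a \<and> f 2 = a \<and> f 3 = b \<and> f 4 = b \<and>
        equiv U R \<and> U // R = {{1}, {2, 3}, {4}} \<and> X = {1} \<longrightarrow>
          f ` U = V \<and>
          lower_apr U R X = X \<and> upper_apr U R X = X \<and>
          f ` X = {a} \<and>
          rel_map U f R = {(a, a), (b, b), (a, b), (b, a)} \<and>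
          equiv V (rel_map U f R) \<and>
          lower_apr V (rel_map U f R) (f ` X) = {} \<and>
          upper_apr V (rel_map U f R) (f ` X) = V \<and>
          f ` lower_apr U R X = f ` X \<and>
          f ` lower_apr U R X \<supset> lower_apr V (rel_map U f R) (f ` X) \<and>
          f ` upper_apr U R X = f ` X \<and>
          f ` upper_apr U R X \<subset> upper_apr V (rel_map U f R) (f ` X)"
    (is "\<forall>U V a b f R X. ?hyp U V a b f R X \<longrightarrow> ?concl U V a b f R X")
  proof (intro allI impI)
    fix U :: "nat set" and V :: "'b set" and a b :: 'b and f :: "nat \<Rightarrow> 'b"
      and R :: "nat rel" and X :: "nat set"
    assume hyp: "?hyp U V a b f R X"
    then have "U = {1, 2, 3, 4}" "V = {a, b}" "X = {1}" by blast+
    interpret merging_example a b f R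
      using hyp by unfold_locales auto
    have im: "f ` {1} = {a}" using f(1) by simp
    have rel: "rel_map {1, 2, 3, 4} f R = {(a, a), (b, b), (a, b), (b, a)}"
      unfolding rel_map_eq by auto
    have equiv_rel: "equiv {a, b} (rel_map {1, 2, 3, 4} f R)"
      unfolding rel_map_eq by (rule equiv_Times_self)
    have psub: "{} \<subset> {a}" "{a} \<subset> {a, b}" using ab by auto
    show "?concl U V a b f R X"
      unfolding \<open>U = _\<close> \<open>V = _\<close> \<open>X = _\<close> lower_apr_eq upper_apr_eq im
        lower_apr_rel_map upper_apr_rel_map
      by (intro conjI refl image_eq rel equiv_rel psub)
  qed
next
  define f :: "nat \<Rightarrow> nat" where "f = (\<lambda>n. if n \<le> 2 then 0 else 1)"
  define R :: "nat rel" where "R = {(1, 1), (2, 2), (2, 3), (3, 2), (3, 3), (4, 4)}"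
  interpret merging_example 0 1 f R
    unfolding f_def R_def by (rule merging_example_nat)
  have im: "f ` {1} = {0}" using f(1) by simp
  have lower: "\<not> f ` lower_apr {1, 2, 3, 4} R {1} \<subseteq> lower_apr {0, 1} (rel_map {1, 2, 3, 4} f R) (f ` {1})"
    unfolding lower_apr_eq im lower_apr_rel_map by blast
  have upper: "\<not> f ` upper_apr {1, 2, 3, 4} R {1} \<supseteq> upper_apr {0, 1} (rel_map {1, 2, 3, 4} f R) (f ` {1})"
    unfolding upper_apr_eq im upper_apr_rel_map by simp
  have exact: "lower_apr {1, 2, 3, 4} R {1} = upper_apr {1, 2, 3, 4} R {1}"
    using lower_apr_eq upper_apr_eq by simp
  show "\<not> (\<forall>(U :: nat set) (V :: nat set) f R X. rel_map_setting U V f R X \<longrightarrow>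
          f ` lower_apr U R X \<subseteq> lower_apr V (rel_map U f R) (f ` X))"
    \<comment> \<open>The witnesses stay schematic until unification with \<open>setting\<close>
      fixes all of them.\<close>
    unfolding not_all not_imp by (intro exI conjI) (rule setting, rule lower)
  show "\<not> (\<forall>(U :: nat set) (V :: nat set) f R X. rel_map_setting U V f R X \<longrightarrow>
          f ` upper_apr U R X \<supseteq> upper_apr V (rel_map U f R) (f ` X))"
    unfolding not_all not_imp by (intro exI conjI) (rule setting, rule upper)
  show "\<not> (\<forall>(U :: nat set) (V :: nat set) f R X. rel_map_setting U V f R X \<and>
          lower_apr U R X = upper_apr U R X \<and> upper_apr U R X = X \<longrightarrow>
          f ` lower_apr U R X = lower_apr V (rel_map U f R) (f ` X) \<and>
          lower_apr V (rel_map U f R) (f ` X) = f ` X)"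
    \<comment> \<open>The set {1} is a union of classes, so the exactness hypothesis holds by
      \<open>exact\<close> and \<open>upper_apr_eq\<close>. The first claimed equality would then
      entail the inclusion already refuted by \<open>lower\<close>.\<close>
    unfolding not_all not_imp
    by (intro exI conjI, rule setting, rule exact, rule upper_apr_eq)
      (use lower in blast)
  show "\<not> (\<forall>(U :: nat set) (V :: nat set) f R X. rel_map_setting U V f R X \<and>
          lower_apr U R X = upper_apr U R X \<and> upper_apr U R X = X \<longrightarrow>
          f ` upper_apr U R X = upper_apr V (rel_map U f R) (f ` X) \<and>
          upper_apr V (rel_map U f R) (f ` X) = f ` X)"
    unfolding not_all not_imp
    by (intro exI conjI, rule setting, rule exact, rule upper_apr_eq)
      (use upper in blast)
qed

end
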